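(* Let $\mathcal{H}$ be a separable infinite-dimensional complex Hilbert space. Every operator $T\in\mathcal{B}(\mathcal{H})$ is a direct sum of operators of the block tridiagonal form $$\begin{pmatrix} C_1 & A_1 & 0 & \\ B_1 & C_2 & A_2 & \\ 0 & B_2 & C_3 & \ddots\\ & & \ddots & \ddots\end{pmatrix}$$ where the sizes of the diagonal blocks $C_1,C_2,C_3,C_4,\dots$ in each summand are $1\times1$, $2\times2$, $4\times4$, $8\times8$, $\dots$ and the sizes of the off-diagonal blocks are forced accordingly.
   Context: $\mathcal{B}(\mathcal{H})$ denotes the bounded linear operators on $\mathcal{H}$. The direct sum is orthogonal: $\mathcal{H}$ is an orthogonal direct sum of subspaces reducing for $T$ (invariant under both $T$ and $T^*$), and the summands are the restrictions of $T$ to these subspaces. An operator is of the displayed form if its matrix with respect to some orthonormal basis of the space on which it acts is of that form; all matrix entries outside the blocks $C_k,A_k,B_k$ ($k\ge1$) are zero. Thus $C_k$ is $2^{k-1}\times2^{k-1}$, and the forced off-diagonal sizes are $2^{k-1}\times2^{k}$ for $A_k$ and $2^{k}\times2^{k-1}$ for $B_k$. *)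

theory Defs
  imports "HOL-Analysis.Analysis"
begin

section \<open>Complex Hilbert spaces\<close>

class scaleC = scaleR +
  fixes scaleC :: "complex \<Rightarrow> 'a \<Rightarrow> 'a" (infixr "*\<^sub>C" 75)
  assumes scaleR_scaleC: "scaleR r x = scaleC (complex_of_real r) x"

class complex_vector = scaleC + ab_group_add +
  assumes scaleC_add_right: "a *\<^sub>C (x + y) = a *\<^sub>C x + a *\<^sub>C y"
    and scaleC_add_left: "(a + b) *\<^sub>C x = a *\<^sub>C x + b *\<^sub>C x"
    and scaleC_scaleC: "a *\<^sub>C b *\<^sub>C x = (a * b) *\<^sub>C x"
    and scaleC_one: "1 *\<^sub>C x = x"

global_interpretation complex_vector:
  vector_space "scaleC :: complex \<Rightarrow> 'a \<Rightarrow> 'a :: complex_vector"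
  defines csubspace = complex_vector.subspace
    and cspan = complex_vector.span
  by unfold_locales
    (simp_all add: scaleC_add_right scaleC_add_left scaleC_scaleC scaleC_one)

text \<open>
  The complex inner product is linear in its first argument.  The real inner product of the
  superclass is its real part, so positivity, definiteness, the norm and the topology all come
  from \<^class>\<open>real_inner\<close>; see \<open>norm_eq_sqrt_cinner\<close> and \<open>cinner_self\<close> below.
\<close>

class complex_inner = complex_vector + real_inner +
  fixes cinner :: "'a \<Rightarrow> 'a \<Rightarrow> complex"
  assumes cinner_commute: "cinner x y = cnj (cinner y x)"
    and cinner_add_left: "cinner (x + y) z = cinner x z + cinner y z"
    and cinner_scaleC_left: "cinner (a *\<^sub>C x) y = a * cinner x y"
    and inner_eq_Re_cinner: "inner x y = Re (cinner x y)"

class chilbert_space = complex_inner + complete_space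

lemma norm_eq_sqrt_cinner: "norm (x :: 'a :: complex_inner) = sqrt (Re (cinner x x))"
  by (simp add: norm_eq_sqrt_inner inner_eq_Re_cinner)

lemma cinner_self: "cinner x x = complex_of_real ((norm (x :: 'a :: complex_inner))\<^sup>2)"
proof (rule complex_eqI)
  show "Re (cinner x x) = Re (complex_of_real ((norm x)\<^sup>2))"
    by (simp add: power2_norm_eq_inner inner_eq_Re_cinner)
  have "Im (cinner x x) = - Im (cinner x x)"
    by (subst cinner_commute) simp
  then show "Im (cinner x x) = Im (complex_of_real ((norm x)\<^sup>2))"
    by simp
qed


section \<open>Operators and reducing subspaces\<close>

definition bounded_clinear :: "('a :: complex_inner \<Rightarrow> 'b :: complex_inner) \<Rightarrow> bool" where
  "bounded_clinear T \<longleftrightarrow> bounded_linear T \<and> (\<forall>c x. T (c *\<^sub>C x) = c *\<^sub>C T x)"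

text \<open>
  As for the library's real \<^const>\<open>adjoint\<close>, existence (for bounded operators on Hilbert spaces)
  is a theorem and not part of the definition; uniqueness is immediate.
\<close>

definition cadjoint :: "('a :: complex_inner \<Rightarrow> 'b :: complex_inner) \<Rightarrow> 'b \<Rightarrow> 'a" where
  "cadjoint T = (SOME S. \<forall>x y. cinner (T x) y = cinner x (S y))"

definition reducing_subspace :: "('a :: complex_inner \<Rightarrow> 'a) \<Rightarrow> 'a set \<Rightarrow> bool" where
  "reducing_subspace T M \<longleftrightarrow>
     csubspace M \<and> closed M \<and> T ` M \<subseteq> M \<and> cadjoint T ` M \<subseteq> M"

definition orthogonal_direct_sum :: "'a :: complex_inner set set \<Rightarrow> bool" where
  "orthogonal_direct_sum \<M> \<longleftrightarrow>
     (\<forall>M\<in>\<M>. csubspace M \<and> closed M) \<and>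
     (\<forall>M\<in>\<M>. \<forall>N\<in>\<M>. M \<noteq> N \<longrightarrow> (\<forall>x\<in>M. \<forall>y\<in>N. cinner x y = 0)) \<and>
     closure (cspan (\<Union>\<M>)) = UNIV"


section \<open>Matrices and block tridiagonal form\<close>

text \<open>
  Orthonormal bases are indexed by all of \<^typ>\<open>nat\<close>, since the matrices are infinite with every block present;
  a space with such a basis is infinite-dimensional.
\<close>

definition orthonormal_basis_of :: "(nat \<Rightarrow> 'a :: complex_inner) \<Rightarrow> 'a set \<Rightarrow> bool" where
  "orthonormal_basis_of e M \<longleftrightarrow>
     (\<forall>i j. cinner (e i) (e j) = (if i = j then 1 else 0)) \<and>
     closure (cspan (range e)) = M"

definition matrix_of :: "(nat \<Rightarrow> 'a :: complex_inner) \<Rightarrow> ('a \<Rightarrow> 'a) \<Rightarrow> nat \<Rightarrow> nat \<Rightarrow> complex" where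
  "matrix_of e T i j = cinner (T (e j)) (e i)"

text \<open>
  Given block sizes \<open>d 0, d 1, d 2, \<dots>\<close>, the index set \<^typ>\<open>nat\<close> is cut into consecutive
  intervals, the \<open>k\<close>-th of which has \<open>d k\<close> elements.
\<close>

definition block :: "(nat \<Rightarrow> nat) \<Rightarrow> nat \<Rightarrow> nat set" where
  "block d k = {(\<Sum>j<k. d j) ..< (\<Sum>j<Suc k. d j)}"

definition block_tridiagonal :: "(nat \<Rightarrow> nat) \<Rightarrow> (nat \<Rightarrow> nat \<Rightarrow> complex) \<Rightarrow> bool" where
  "block_tridiagonal d A \<longleftrightarrow>
     (\<forall>k l. \<forall>i\<in>block d k. \<forall>j\<in>block d l. k > l + 1 \<or> l > k + 1 \<longrightarrow> A i j = 0)"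

text \<open>Only the restriction of \<open>T\<close> to \<open>M\<close> matters here, as the basis vectors lie in \<open>M\<close>.\<close>

definition has_block_tridiagonal_form_on ::
  "(nat \<Rightarrow> nat) \<Rightarrow> ('a :: complex_inner \<Rightarrow> 'a) \<Rightarrow> 'a set \<Rightarrow> bool" where
  "has_block_tridiagonal_form_on d T M \<longleftrightarrow>
     (\<exists>e. orthonormal_basis_of e M \<and> block_tridiagonal d (matrix_of e T))"

end

theory Submission imports Defs begin

text \<open>
  An orthonormal sequence \<open>e\<close> with \<open>T (e j)\<close> and \<open>T\<^sup>* (e j)\<close> in the span of
  \<open>e 0, \<dots>, e (2 j + 2)\<close> spans a reducing subspace on which \<open>T\<close> has the required form.
  In every infinite-dimensional reducing subspace such a sequence arises by orthonormalizing
  \<open>e 0, T (e 0), T\<^sup>* (e 0), T (e 1), T\<^sup>* (e 1), \<dots>\<close> breadth first, where a vector that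
  is already in the span of its predecessors is replaced by an arbitrary new one.  Hence the
  complement of a maximal orthogonal family of such subspaces is finite-dimensional.  The same
  procedure yields a finite basis of the complement; putting it in front of the sequence of one
  member of the family only delays that sequence, so the enlarged subspace is of the same kind.
\<close>

section \<open>Orthogonal projection and adjoints\<close>

text \<open>A sequence in \<open>V\<close> minimizing the squared distance to \<open>x\<close> is
  Cauchy by the parallelogram law, and first-order optimality of its limit is orthogonality.\<close>

lemma orthogonal_projection_exists:
  fixes V :: "'a :: {real_inner, complete_space} set"
  assumes V: "subspace V" "closed V"
  obtains v where "v \<in> V" "\<And>w. w \<in> V \<Longrightarrow> inner (x - v) w = 0"
proof -
  define Q where "Q = (\<lambda>y. (norm (x - y))\<^sup>2) ` V"
  define D where "D = Inf Q"
  have Qne: "Q \<noteq> {}" using subspace_0[OF V(1)] by (auto simp: Q_def)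
  have bdd: "bdd_below Q" by (rule bdd_belowI[of _ 0]) (auto simp: Q_def)
  have D_le: "D \<le> (norm (x - y))\<^sup>2" if "y \<in> V" for y
    unfolding D_def using bdd that by (intro cInf_lower) (auto simp: Q_def)
  have "\<exists>y\<in>V. (norm (x - y))\<^sup>2 < D + 1 / Suc n" for n
  proof -
    have "Inf Q < D + 1 / Suc n" by (simp add: D_def)
    then show ?thesis using cInf_lessD[OF Qne] by (fastforce simp: Q_def)
  qed
  then obtain y where yV: "\<And>n. y n \<in> V" and yD: "\<And>n. (norm (x - y n))\<^sup>2 < D + 1 / Suc n"
    by metis
  have est: "(norm (y m - y n))\<^sup>2 < 2 / Suc m + 2 / Suc n" for m n
  proof -
    \<comment> \<open>The midpoint lies in \<open>V\<close>, so its squared distance is at least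
      \<open>D\<close>; the parallelogram identity turns this into a bound on the gap.\<close>
    define z where "z = (1/2) *\<^sub>R (y m + y n)"
    have "z \<in> V" unfolding z_def using V yV by (simp add: subspace_add subspace_mul)
    moreover have "(norm (y m - y n))\<^sup>2 =
        2 * (norm (x - y m))\<^sup>2 + 2 * (norm (x - y n))\<^sup>2 - 4 * (norm (x - z))\<^sup>2"
      unfolding z_def power2_norm_eq_inner
      by (simp add: inner_simps inner_commute algebra_simps)
    moreover have "2 / real (Suc k) = 2 * (1 / real (Suc k))" for k by simp
    ultimately show ?thesis using D_le[of z] yD[of m] yD[of n] by linarith
  qed
  have "Cauchy y"
  proof (rule metric_CauchyI)
    fix e :: real assume "e > 0"
    obtain N where N: "4 / e\<^sup>2 < real N" using reals_Archimedean2 by blast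
    have "dist (y m) (y n) < e" if "m \<ge> N" "n \<ge> N" for m n
    proof -
      have k: "2 / real (Suc k) < e\<^sup>2 / 2" if "k \<ge> N" for k
      proof -
        have "4 / e\<^sup>2 < real (Suc k)" using N that by linarith
        then show ?thesis using \<open>e > 0\<close> by (simp add: field_simps)
      qed
      have "(norm (y m - y n))\<^sup>2 < e\<^sup>2" using est[of m n] k[OF that(1)] k[OF that(2)] by linarith
      then show ?thesis using \<open>e > 0\<close> by (simp add: dist_norm power2_less_imp_less)
    qed
    then show "\<exists>N. \<forall>m\<ge>N. \<forall>n\<ge>N. dist (y m) (y n) < e" by blast
  qed
  then obtain v where lim: "y \<longlonglongrightarrow> v" using Cauchy_convergent convergent_def by blast
  have vV: "v \<in> V" using closed_sequentially[OF V(2)] yV lim by blast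
  have "(\<lambda>n. (norm (x - y n))\<^sup>2) \<longlonglongrightarrow> (norm (x - v))\<^sup>2" by (intro tendsto_intros lim)
  moreover have "(\<lambda>n. D + 1 / Suc n) \<longlonglongrightarrow> D + 0"
    by (intro tendsto_intros LIMSEQ_inverse_real_of_nat[unfolded inverse_eq_divide])
  ultimately have vD: "(norm (x - v))\<^sup>2 \<le> D"
    by (rule LIMSEQ_le[THEN order_trans]) (use yD less_imp_le in auto)
  have "inner (x - v) w = 0" if w: "w \<in> V" for w
  proof (cases "w = 0")
    case False
    \<comment> \<open>This coefficient minimizes the distance from \<open>x\<close> along the line
      \<open>v + t *\<^sub>R w\<close>. The gain
      \<open>(inner (x - v) w)\<^sup>2 / inner w w\<close> cannot be positive, because
      \<open>v\<close> is already optimal.\<close>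
    define t where "t = inner (x - v) w / inner w w"
    have ww: "inner w w > 0" using False by simp
    have "v + t *\<^sub>R w \<in> V" using V vV w by (simp add: subspace_add subspace_mul)
    then have "(norm (x - v))\<^sup>2 \<le> (norm ((x - v) - t *\<^sub>R w))\<^sup>2"
      using D_le[of "v + t *\<^sub>R w"] vD unfolding diff_diff_eq by linarith
    also have "\<dots> = (norm (x - v))\<^sup>2 - 2 * (t * inner (x - v) w) + t * (t * inner w w)"
      unfolding power2_norm_eq_inner by (simp add: inner_diff inner_commute)
    also have "\<dots> = (norm (x - v))\<^sup>2 - (inner (x - v) w)\<^sup>2 / inner w w"
      using ww unfolding t_def by (simp add: field_simps power2_eq_square)
    finally have "(inner (x - v) w)\<^sup>2 / inner w w \<le> 0" by simp
    then have "(inner (x - v) w)\<^sup>2 \<le> 0" using ww by (simp add: divide_le_0_iff)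
    then show ?thesis by simp
  qed simp
  then show thesis using that vV by blast
qed

text \<open>A vector \<open>z\<close> orthogonal to the kernel of \<open>g\<close> determines
  \<open>g\<close> up to scaling: subtracting a suitable multiple of \<open>z\<close> from any
  \<open>x\<close> lands in the kernel.\<close>

lemma real_riesz_representation:
  fixes g :: "'a :: {real_inner, complete_space} \<Rightarrow> real"
  assumes "bounded_linear g"
  obtains y where "\<And>x. g x = inner x y"
proof (cases "\<forall>x. g x = 0")
  case True
  then show thesis using that[of 0] by simp
next
  case False
  interpret bounded_linear g by fact
  from False obtain u where u: "g u \<noteq> 0" by blast
  define V where "V = {x. g x = 0}"
  have "subspace V" by (auto simp: V_def subspace_def add scaleR zero)
  moreover have "closed V"
    unfolding V_def by (intro closed_Collect_eq continuous_intros continuous_on)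
  ultimately obtain v where v: "v \<in> V" "\<And>w. w \<in> V \<Longrightarrow> inner (u - v) w = 0"
    using orthogonal_projection_exists by blast
  define z where "z = u - v"
  have gz: "g z \<noteq> 0" using u v by (simp add: z_def diff V_def)
  then have "z \<noteq> 0" using zero by auto
  then have zz: "inner z z \<noteq> 0" by simp
  have "g x = inner x ((g z / inner z z) *\<^sub>R z)" for x
  proof -
    have "x - (g x / g z) *\<^sub>R z \<in> V" using gz by (simp add: V_def diff scaleR)
    then have "inner z (x - (g x / g z) *\<^sub>R z) = 0" using v(2) z_def by blast
    then have "inner z x = g x / g z * inner z z" by (simp add: inner_simps)
    then show ?thesis using gz zz by (simp add: inner_commute field_simps)
  qed
  then show thesis by (rule that)
qed

section \<open>Complex inner product and the adjoint\<close>

lemma cinner_eq_Complex_inner: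
  "cinner x y = Complex (inner x y) (inner x (\<i> *\<^sub>C y))"
proof -
  \<comment> \<open>Conjugate-linearity in the second argument produces the factor
    \<open>- \<i>\<close>, which moves the imaginary part into the real part.\<close>
  have "cinner x (\<i> *\<^sub>C y) = cnj (\<i> * cinner y x)"
    by (subst cinner_commute) (simp add: cinner_scaleC_left)
  also have "\<dots> = - \<i> * cinner x y" using cinner_commute[of x y] by simp
  finally show ?thesis by (simp add: inner_eq_Re_cinner complex_eq_iff)
qed

lemma cinner_add_right: "cinner x (y + z) = cinner x y + cinner x (z :: 'a :: complex_inner)"
  by (metis cinner_add_left cinner_commute complex_cnj_add)

lemma cinner_scaleC_right: "cinner x (a *\<^sub>C y) = cnj a * cinner x (y :: 'a :: complex_inner)"
  by (metis cinner_commute cinner_scaleC_left complex_cnj_mult)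

lemma cinner_zero_left [simp]: "cinner 0 (x :: 'a :: complex_inner) = 0"
  by (metis add_cancel_right_right cinner_add_left)

lemma cinner_diff_left: "cinner (x - y) (z :: 'a :: complex_inner) = cinner x z - cinner y z"
  by (metis add_diff_cancel cinner_add_left diff_add_cancel)

lemma cinner_eq_0_commute: "cinner x (y :: 'a :: complex_inner) = 0 \<longleftrightarrow> cinner y x = 0"
  by (metis cinner_commute complex_cnj_zero)

lemma cinner_sum_left:
  "cinner (\<Sum>i\<in>A. f i) (y :: 'a :: complex_inner) = (\<Sum>i\<in>A. cinner (f i) y)"
  by (induction A rule: infinite_finite_induct) (auto simp: cinner_add_left)

lemma cinner_self_eq_0_iff: "cinner x x = 0 \<longleftrightarrow> (x :: 'a :: complex_inner) = 0"
  by (simp add: cinner_self)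

lemma norm_scaleC: "norm (a *\<^sub>C (x :: 'a :: complex_inner)) = cmod a * norm x"
proof -
  have "complex_of_real ((norm (a *\<^sub>C x))\<^sup>2) = a * cnj a * complex_of_real ((norm x)\<^sup>2)"
    by (simp only: cinner_self[symmetric] cinner_scaleC_left cinner_scaleC_right) simp
  also have "\<dots> = complex_of_real ((cmod a * norm x)\<^sup>2)"
    by (simp only: complex_norm_square[symmetric] power_mult_distrib of_real_mult)
  finally have "(norm (a *\<^sub>C x))\<^sup>2 = (cmod a * norm x)\<^sup>2" using of_real_eq_iff by blast
  then show ?thesis by (simp add: power2_eq_iff_nonneg)
qed

lemma bounded_linear_scaleC: "bounded_linear (\<lambda>x :: 'a :: complex_inner. a *\<^sub>C x)"
  by (rule bounded_linear_intro[where K = "cmod a"])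
    (simp_all add: scaleC_add_right scaleR_scaleC scaleC_scaleC mult.commute norm_scaleC)

text \<open>\<open>cadjoint\<close> is a choice, so an adjoint must be shown to exist. Real Riesz
  represents the real part of \<open>cinner (T x) y\<close>; replacing \<open>x\<close> by
  \<open>\<i> *\<^sub>C x\<close> shows that the same vector represents the imaginary part.\<close>

lemma cadjoint_works:
  fixes T :: "'a :: chilbert_space \<Rightarrow> 'a"
  assumes T: "bounded_clinear T"
  shows "cinner (T x) y = cinner x (cadjoint T y)"
proof -
  have bl: "bounded_linear T" and sc: "\<And>c x. T (c *\<^sub>C x) = c *\<^sub>C T x"
    using T by (auto simp: bounded_clinear_def)
  have "\<exists>z. \<forall>x. cinner (T x) y = cinner x z" for y
  proof -
    have "bounded_linear (\<lambda>x. inner (T x) y)"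
      by (rule bounded_linear_compose[OF bounded_linear_inner_left bl])
    then obtain z where z: "\<And>x. inner (T x) y = inner x z"
      using real_riesz_representation by blast
    have skew: "inner a (\<i> *\<^sub>C b) = - inner (\<i> *\<^sub>C a) b" for a b :: 'a
      by (simp add: inner_eq_Re_cinner cinner_scaleC_left cinner_scaleC_right)
    have "cinner (T x) y = cinner x z" for x
      unfolding cinner_eq_Complex_inner skew using z[of x] z[of "\<i> *\<^sub>C x"] by (simp add: sc)
    then show ?thesis by blast
  qed
  then have "\<exists>S. \<forall>x y. cinner (T x) y = cinner x (S y)" by metis
  then have "\<forall>x y. cinner (T x) y = cinner x (cadjoint T y)"
    unfolding cadjoint_def by (rule someI_ex)
  then show ?thesis by blast
qed

lemma cinner_right_eqI:
  assumes "\<And>x. cinner x y = cinner x (z :: 'a :: complex_inner)"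
  shows "y = z"
proof -
  have "cinner (y - z) (y - z) = 0"
    using assms[of "y - z"] by (metis cinner_commute cinner_diff_left right_minus_eq)
  then show ?thesis by (simp add: cinner_self_eq_0_iff)
qed

text \<open>Linearity follows from uniqueness of the representing vector. For the bound, the squared
  norm of \<open>cadjoint T x\<close> equals \<open>inner (T (cadjoint T x)) x\<close>;
  Cauchy-Schwarz then allows one factor to be cancelled.\<close>

lemma bounded_clinear_cadjoint:
  fixes T :: "'a :: chilbert_space \<Rightarrow> 'a"
  assumes T: "bounded_clinear T"
  shows "bounded_clinear (cadjoint T)"
proof -
  note adj = cadjoint_works[OF T]
  have bl: "bounded_linear T" using T by (simp add: bounded_clinear_def)
  have add: "cadjoint T (x + y) = cadjoint T x + cadjoint T y" for x y
    by (rule cinner_right_eqI) (simp add: adj[symmetric] cinner_add_right)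
  have sc: "cadjoint T (c *\<^sub>C x) = c *\<^sub>C cadjoint T x" for c x
    by (rule cinner_right_eqI) (simp add: adj[symmetric] cinner_scaleC_right)
  obtain K where K: "\<And>x. norm (T x) \<le> norm x * K"
    using bl bounded_linear.bounded by blast
  have bd: "norm (cadjoint T x) \<le> norm x * K" for x
  proof (cases "cadjoint T x = 0")
    \<comment> \<open>Nothing can be cancelled here. Since \<open>K\<close> comes without a sign,
      nonnegativity of the right-hand side is read off from the bound on \<open>T x\<close>.\<close>
    case True
    have "0 \<le> norm x * K" using K[of x] norm_ge_zero order_trans by blast
    then show ?thesis using True by simp
  next
    case False
    let ?s = "cadjoint T x"
    have "norm ?s * norm ?s = inner ?s ?s"
      by (simp add: power2_norm_eq_inner[symmetric] power2_eq_square)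
    also have "\<dots> = inner (T ?s) x" by (simp add: inner_eq_Re_cinner adj)
    also have "\<dots> \<le> norm (T ?s) * norm x" by (rule norm_cauchy_schwarz)
    also have "\<dots> \<le> (norm ?s * K) * norm x" by (intro mult_right_mono K) simp
    finally have "norm ?s * norm ?s \<le> norm ?s * (norm x * K)" by (simp add: ac_simps)
    then show ?thesis using False by simp
  qed
  show ?thesis unfolding bounded_clinear_def
    by (intro conjI allI bounded_linear_intro[where K = K] add bd sc)
      (simp add: scaleR_scaleC sc)
qed


section \<open>Closed subspaces\<close>

lemma csubspace_imp_subspace: "csubspace V \<Longrightarrow> subspace V"
  unfolding complex_vector.subspace_def subspace_def by (simp add: scaleR_scaleC)

lemma csubspace_closure:
  fixes V :: "'a :: complex_inner set"
  assumes V: "csubspace V"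
  shows "csubspace (closure V)"
proof -
  have "x + y \<in> closure V" if xy: "x \<in> closure V" "y \<in> closure V" for x y
  proof -
    obtain f g where "\<And>n. f n \<in> V" "f \<longlonglongrightarrow> x" "\<And>n. g n \<in> V" "g \<longlonglongrightarrow> y"
      using xy unfolding closure_sequential by blast
    then have "(\<lambda>n. f n + g n) \<longlonglongrightarrow> x + y" "\<And>n. f n + g n \<in> V"
      using V by (auto intro: tendsto_add simp: complex_vector.subspace_def)
    then show ?thesis unfolding closure_sequential by (intro exI[of _ "\<lambda>n. f n + g n"]) auto
  qed
  moreover have "c *\<^sub>C x \<in> closure V" if "x \<in> closure V" for c x
  proof -
    have "(\<lambda>x. c *\<^sub>C x) ` closure V \<subseteq> closure ((\<lambda>x. c *\<^sub>C x) ` V)"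
      by (rule closure_bounded_linear_image_subset[OF bounded_linear_scaleC])
    also have "\<dots> \<subseteq> closure V"
      using V by (intro closure_mono) (auto simp: complex_vector.subspace_def)
    finally show ?thesis using that by blast
  qed
  moreover have "0 \<in> closure V"
    using V closure_subset complex_vector.subspace_0 by blast
  ultimately show ?thesis unfolding complex_vector.subspace_def by blast
qed

definition ortho :: "'a :: complex_inner set \<Rightarrow> 'a set" where
  "ortho A = {x. \<forall>y\<in>A. cinner x y = 0}"

lemma csubspace_ortho: "csubspace (ortho A)"
  by (auto simp: ortho_def complex_vector.subspace_def cinner_add_left cinner_scaleC_left)

text \<open>Writing both parts of \<open>cinner\<close> as real inner products exhibits the
  complement as an intersection of zero sets of continuous functions.\<close>

lemma closed_ortho: "closed (ortho A)"
proof -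
  have "ortho A = (\<Inter>y\<in>A. {x. inner x y = 0} \<inter> {x. inner x (\<i> *\<^sub>C y) = 0})"
    by (auto simp: ortho_def cinner_eq_Complex_inner complex_eq_iff)
  moreover have "closed {x. inner x y = 0}" for y :: 'a
    by (intro closed_Collect_eq continuous_intros)
  ultimately show ?thesis by (auto intro!: closed_INT closed_Int)
qed

lemma closure_cspan_minimal:
  assumes "A \<subseteq> V" "csubspace V" "closed V"
  shows "closure (cspan A) \<subseteq> V"
  using assms by (intro closure_minimal complex_vector.span_minimal)

lemma subset_closure_cspan: "A \<subseteq> closure (cspan A)"
  using closure_subset complex_vector.span_superset by blast

lemma csubspace_closure_cspan: "csubspace (closure (cspan (A :: 'a :: complex_inner set)))"
  by (intro csubspace_closure complex_vector.subspace_span)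

lemma subset_ortho_commute: "A \<subseteq> ortho B \<longleftrightarrow> B \<subseteq> ortho A"
  unfolding ortho_def using cinner_eq_0_commute by blast

text \<open>The residual of any vector after projection to \<open>V\<close> lies in
  \<open>ortho V\<close>, hence vanishes. This is the density criterion for the final
  family.\<close>

lemma closed_csubspace_eq_UNIV:
  fixes V :: "'a :: chilbert_space set"
  assumes V: "csubspace V" "closed V" and triv: "ortho V \<subseteq> {0}"
  shows "V = UNIV"
proof -
  have "x \<in> V" for x
  proof -
    obtain v where v: "v \<in> V" "\<And>w. w \<in> V \<Longrightarrow> inner (x - v) w = 0"
      using orthogonal_projection_exists[OF csubspace_imp_subspace[OF V(1)] V(2)] by blast
    \<comment> \<open>Real orthogonality to both \<open>w\<close> and
      \<open>\<i> *\<^sub>C w\<close>, which lies in \<open>V\<close> as well, kills both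
      parts.\<close>
    have "cinner (x - v) w = 0" if "w \<in> V" for w
      using that v(2) V(1)
      by (simp add: cinner_eq_Complex_inner complex_eq_iff complex_vector.subspace_def)
    then have "x - v \<in> ortho V" by (simp add: ortho_def)
    then show ?thesis using triv v(1) by auto
  qed
  then show ?thesis by blast
qed

lemma cspan_image_subset:
  assumes T: "bounded_clinear T" and A: "\<And>a. a \<in> A \<Longrightarrow> T a \<in> cspan B"
  shows "T ` cspan A \<subseteq> cspan B"
proof -
  have add: "T (x + y) = T x + T y" and sc: "T (c *\<^sub>C x) = c *\<^sub>C T x" for c x y
    using T by (auto simp: bounded_clinear_def bounded_linear.linear linear_add)
  have "T x \<in> cspan B" if "x \<in> cspan A" for x
    using that
  proof (induction rule: complex_vector.span_induct_alt)
    case base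
    have "T 0 = 0" using add[of 0 0] by simp
    then show ?case by (simp add: complex_vector.span_zero)
  next
    case (step c x y)
    then show ?case
      by (simp add: add sc complex_vector.span_add complex_vector.span_scale A)
  qed
  then show ?thesis by blast
qed

lemma closure_cspan_invariant:
  assumes T: "bounded_clinear T" and A: "\<And>a. a \<in> A \<Longrightarrow> T a \<in> cspan A"
  shows "T ` closure (cspan A) \<subseteq> closure (cspan A)"
proof -
  have "T ` closure (cspan A) \<subseteq> closure (T ` cspan A)"
    using T by (intro closure_bounded_linear_image_subset) (simp add: bounded_clinear_def)
  also have "\<dots> \<subseteq> closure (cspan A)"
    by (intro closure_mono cspan_image_subset[OF T A])
  finally show ?thesis .
qed


section \<open>Tame sequences\<close>

text \<open>
  The bound \<open>2 * j + 2\<close> is the last position that can be filled when a queue starts with one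
  vector and processing each of the entries \<open>0, \<dots>, j\<close> appends at most two.  It lies at most
  one dyadic block after \<open>j\<close>.
\<close>

definition tame :: "('a :: complex_inner \<Rightarrow> 'a) \<Rightarrow> (nat \<Rightarrow> 'a) \<Rightarrow> bool" where
  "tame T e \<longleftrightarrow>
     (\<forall>i j. cinner (e i) (e j) = (if i = j then 1 else 0)) \<and>
     (\<forall>j. T (e j) \<in> cspan (e ` {..2 * j + 2}) \<and> cadjoint T (e j) \<in> cspan (e ` {..2 * j + 2}))"

text \<open>Invariance under both operators holds on the generators, passes to the span by linearity
  and to its closure by continuity.\<close>

lemma tame_reducing_subspace:
  fixes T :: "'a :: chilbert_space \<Rightarrow> 'a"
  assumes T: "bounded_clinear T" and e: "tame T e"
  shows "reducing_subspace T (closure (cspan (range e)))"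
proof -
  have "cspan (e ` {..2 * j + 2}) \<subseteq> cspan (range e)" for j
    by (intro complex_vector.span_mono) auto
  then have "T a \<in> cspan (range e) \<and> cadjoint T a \<in> cspan (range e)" if "a \<in> range e" for a
    using e that unfolding tame_def by blast
  then show ?thesis
    unfolding reducing_subspace_def
    using closure_cspan_invariant[OF T] closure_cspan_invariant[OF bounded_clinear_cadjoint[OF T]]
    by (simp add: csubspace_closure_cspan)
qed

section \<open>Dyadic blocks and vanishing matrix entries\<close>

lemma sum_power_2: "(\<Sum>j<k. 2 ^ j) = (2 :: nat) ^ k - 1"
  by (induction k) auto

text \<open>Block \<open>l\<close> ends at \<open>2 ^ (l + 1) - 2\<close>, so
  \<open>2 * j + 2\<close> is at most \<open>2 ^ (l + 2) - 2\<close>, while block \<open>k\<close>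
  starts at \<open>2 ^ k - 1\<close>. Doubling block sizes thus match the growth bound of
  \<open>tame\<close>.\<close>

lemma block_power_2_gap:
  assumes i: "i \<in> block (\<lambda>k. 2 ^ k) k" and j: "j \<in> block (\<lambda>k. 2 ^ k) l" and "k > l + 1"
  shows "2 * j + 2 < i"
proof -
  have "(2 :: nat) ^ (l + 2) \<le> 2 ^ k" using assms(3) by (intro power_increasing) auto
  moreover have "j < 2 ^ (l + 1) - 1" "2 ^ k - 1 \<le> i"
    using i j by (simp_all only: block_def sum_power_2 atLeastLessThan_iff Suc_eq_plus1)
  ultimately show ?thesis by simp
qed

lemma tame_cinner_eq_0:
  assumes e: "tame T e" and x: "x \<in> cspan (e ` {..n})" and "n < i"
  shows "cinner x (e i) = 0"
proof -
  have "e ` {..n} \<subseteq> ortho {e i}" using e \<open>n < i\<close> by (auto simp: ortho_def tame_def)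
  then have "cspan (e ` {..n}) \<subseteq> ortho {e i}"
    by (intro complex_vector.span_minimal csubspace_ortho)
  then show ?thesis using x by (auto simp: ortho_def)
qed

text \<open>Entries below the band vanish by the growth bound for \<open>T\<close>. Entries above it
  vanish by the bound for the adjoint, after moving \<open>T\<close> to the other side of the inner
  product.\<close>

lemma tame_has_block_tridiagonal_form:
  fixes T :: "'a :: chilbert_space \<Rightarrow> 'a"
  assumes T: "bounded_clinear T" and e: "tame T e"
  shows "has_block_tridiagonal_form_on (\<lambda>k. 2 ^ k) T (closure (cspan (range e)))"
proof -
  have "matrix_of e T i j = 0"
    if "i \<in> block (\<lambda>k. 2 ^ k) k" "j \<in> block (\<lambda>k. 2 ^ k) l" "k > l + 1 \<or> l > k + 1" for i j k l
    using that(3)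
  proof
    assume "k > l + 1"
    then have "2 * j + 2 < i" using block_power_2_gap that by blast
    then show ?thesis using e tame_cinner_eq_0 unfolding matrix_of_def tame_def by blast
  next
    assume "l > k + 1"
    then have "2 * i + 2 < j" using block_power_2_gap that by blast
    then have "cinner (cadjoint T (e i)) (e j) = 0"
      using e tame_cinner_eq_0 unfolding tame_def by blast
    then show ?thesis
      unfolding matrix_of_def cadjoint_works[OF T] by (subst cinner_eq_0_commute)
  qed
  then have "block_tridiagonal (\<lambda>k. 2 ^ k) (matrix_of e T)"
    unfolding block_tridiagonal_def by blast
  moreover have "orthonormal_basis_of e (closure (cspan (range e)))"
    using e by (simp add: orthonormal_basis_of_def tame_def)
  ultimately show ?thesis unfolding has_block_tridiagonal_form_on_def by blast
qed

section \<open>Breadth-first orthonormalization\<close>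

lemma orthonormal_extension:
  fixes F :: "'a :: complex_inner set"
  assumes fin: "finite F" and unit: "\<And>x. x \<in> F \<Longrightarrow> norm x = 1"
    and orth: "\<And>x y. \<lbrakk>x \<in> F; y \<in> F; x \<noteq> y\<rbrakk> \<Longrightarrow> cinner x y = 0"
    and K: "csubspace K" "F \<subseteq> K" "\<not> K \<subseteq> cspan F" and t: "t \<in> K"
  obtains r where "r \<in> K" "norm r = 1" "\<And>x. x \<in> F \<Longrightarrow> cinner r x = 0"
    "t \<in> cspan (insert r F)"
proof -
  \<comment> \<open>The vector fed to Gram-Schmidt is \<open>t\<close> itself when it is new, and
    otherwise any element of \<open>K\<close> outside the span; either way \<open>t\<close> ends up
    in the enlarged span.\<close>
  obtain s where s: "s \<in> K" "s \<notin> cspan F" "t \<in> cspan F \<or> s = t"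
    using K(3) t by (cases "t \<in> cspan F") auto
  define p where "p = (\<Sum>x\<in>F. cinner s x *\<^sub>C x)"
  have p: "p \<in> cspan F" unfolding p_def
    by (intro complex_vector.span_sum complex_vector.span_scale complex_vector.span_base)
  have perp: "cinner (s - p) y = 0" if y: "y \<in> F" for y
  proof -
    have "cinner p y = (\<Sum>x\<in>F. if x = y then cinner s y else 0)"
      unfolding p_def cinner_sum_left
    proof (intro sum.cong refl)
      fix x assume "x \<in> F"
      then show "cinner (cinner s x *\<^sub>C x) y = (if x = y then cinner s y else 0)"
        using orth y unit by (simp add: cinner_scaleC_left cinner_self)
    qed
    then show ?thesis using fin y by (simp add: cinner_diff_left)
  qed
  define c where "c = norm (s - p)"
  have c: "c \<noteq> 0" using p s(2) by (auto simp: c_def)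
  define r where "r = complex_of_real (1 / c) *\<^sub>C (s - p)"
  have sr: "s = p + complex_of_real c *\<^sub>C r"
    using c by (simp add: r_def scaleC_scaleC scaleC_one flip: of_real_mult)
  show thesis
  proof (rule that[of r])
    have "p \<in> K" using p complex_vector.span_minimal[OF K(2,1)] by blast
    then show "r \<in> K" unfolding r_def
      by (intro complex_vector.subspace_scale complex_vector.subspace_diff K(1) s(1))
    show "norm r = 1" using c by (simp add: r_def norm_scaleC norm_divide) (simp add: c_def)
    show "cinner r x = 0" if "x \<in> F" for x
      using perp[OF that] by (simp add: r_def cinner_scaleC_left)
    have sub: "cspan F \<subseteq> cspan (insert r F)" by (intro complex_vector.span_mono) auto
    have "s \<in> cspan (insert r F)"
      by (subst sr, intro complex_vector.span_add complex_vector.span_scale)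
        (use sub p in \<open>auto intro: complex_vector.span_base\<close>)
    then show "t \<in> cspan (insert r F)" using s(3) sub by auto
  qed
qed

lemma orthonormal_if_orthogonal_to_predecessors:
  assumes "\<And>n. n < N \<Longrightarrow> norm (e n) = 1"
    and "\<And>i n. \<lbrakk>i < n; n < N\<rbrakk> \<Longrightarrow> cinner (e n) (e i :: 'a :: complex_inner) = 0"
    and "i < N" "j < N"
  shows "cinner (e i) (e j) = (if i = (j :: nat) then 1 else 0)"
proof (cases i j rule: linorder_cases)
  case less
  then show ?thesis using assms cinner_eq_0_commute[of "e i" "e j"] by simp
qed (use assms in \<open>auto simp: cinner_self\<close>)

text \<open>Position \<open>2 * j + 1\<close> is reserved for \<open>T (e j)\<close> and position
  \<open>2 * j + 2\<close> for \<open>S (e j)\<close>. The premises on spans express that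
  \<open>K\<close> is not yet exhausted; afterwards there is no new direction to choose.\<close>

lemma queue_sequence_exists:
  fixes T S :: "'a :: complex_inner \<Rightarrow> 'a"
  assumes K: "csubspace K" and TK: "T ` K \<subseteq> K" and SK: "S ` K \<subseteq> K"
  obtains e :: "nat \<Rightarrow> 'a" where
    "\<And>n. \<not> K \<subseteq> cspan (e ` {..<n}) \<Longrightarrow> e n \<in> K \<and> norm (e n) = 1 \<and> (\<forall>i<n. cinner (e n) (e i) = 0)"
    "\<And>j. \<not> K \<subseteq> cspan (e ` {..<2 * j + 1}) \<Longrightarrow> T (e j) \<in> cspan (e ` {..2 * j + 1})"
    "\<And>j. \<not> K \<subseteq> cspan (e ` {..<2 * j + 2}) \<Longrightarrow> S (e j) \<in> cspan (e ` {..2 * j + 2})"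
proof -
  \<comment> \<open>The target at position 0 is the zero vector, always in the span, so
    \<open>e 0\<close> becomes an arbitrary unit vector of \<open>K\<close>. For positive
    \<open>n\<close> the index consulted is smaller than \<open>n\<close>.\<close>
  define target :: "(nat \<Rightarrow> 'a) \<Rightarrow> nat \<Rightarrow> 'a" where
    "target f n = (if n = 0 then 0 else if odd n then T (f ((n - 1) div 2))
       else S (f ((n - 2) div 2)))" for f n
  \<comment> \<open>The condition is vacuous once \<open>K\<close> is exhausted, so a choice exists
    at every \<open>n\<close> and one total sequence serves both outcomes.\<close>
  define P where "P f n r \<longleftrightarrow> (\<not> K \<subseteq> cspan (f ` {..<n}) \<longrightarrow>
      r \<in> K \<and> norm r = 1 \<and> (\<forall>i<n. cinner r (f i) = 0) \<and>
      target f n \<in> cspan (insert r (f ` {..<n})))" for f n r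
  have "\<exists>e. \<forall>n. P e n (e n)"
  proof (rule dependent_wellorder_choice)
    fix r :: 'a and f g :: "nat \<Rightarrow> 'a" and n :: nat
    assume eq: "\<And>i. i < n \<Longrightarrow> f i = g i"
    have "f ` {..<n} = g ` {..<n}" using eq by auto
    moreover have "target f n = target g n"
      using eq[of "(n - 1) div 2"] eq[of "(n - 2) div 2"] by (auto simp: target_def)
    ultimately show "P f n r = P g n r" using eq by (simp add: P_def)
  next
    fix n :: nat and f :: "nat \<Rightarrow> 'a"
    assume IH: "\<And>i. i < n \<Longrightarrow> P f i (f i)"
    show "\<exists>r. P f n r"
    proof (cases "K \<subseteq> cspan (f ` {..<n})")
      case False
      \<comment> \<open>Spans grow with the index, so non-exhaustion at \<open>n\<close> activates
        the induction hypothesis at all earlier positions.\<close>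
      have "\<not> K \<subseteq> cspan (f ` {..<i})" if "i < n" for i
        using False that complex_vector.span_mono[of "f ` {..<i}" "f ` {..<n}"] by fastforce
      then have f: "f i \<in> K" "norm (f i) = 1" "\<forall>k<i. cinner (f i) (f k) = 0" if "i < n" for i
        using IH[OF that] that by (auto simp: P_def)
      have FK: "f ` {..<n} \<subseteq> K" using f by auto
      have "target f n \<in> K"
        using f(1)[of "(n - 1) div 2"] f(1)[of "(n - 2) div 2"] TK SK K
        by (auto simp: target_def complex_vector.subspace_0)
      moreover have "cinner x y = 0" if "x \<in> f ` {..<n}" "y \<in> f ` {..<n}" "x \<noteq> y" for x y
        using that orthonormal_if_orthogonal_to_predecessors[of n f] f by fastforce
      ultimately obtain r where "r \<in> K" "norm r = 1" "\<And>x. x \<in> f ` {..<n} \<Longrightarrow> cinner r x = 0"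
          "target f n \<in> cspan (insert r (f ` {..<n}))"
        using orthonormal_extension[of "f ` {..<n}" K "target f n"] f K FK False
        by (metis (no_types, lifting) finite_imageI finite_lessThan imageE lessThan_iff)
      then have "P f n r" by (auto simp: P_def)
      then show ?thesis ..
    qed (simp add: P_def)
  qed
  then obtain e where e: "\<And>n. P e n (e n)" by blast
  have ins: "insert (e n) (e ` {..<n}) = e ` {..n}" for n
    by (simp add: lessThan_Suc_atMost[symmetric] lessThan_Suc)
  show thesis
  proof (rule that[of e])
    show "e n \<in> K \<and> norm (e n) = 1 \<and> (\<forall>i<n. cinner (e n) (e i) = 0)"
      if "\<not> K \<subseteq> cspan (e ` {..<n})" for n using e[of n] that by (auto simp: P_def)
    show "T (e j) \<in> cspan (e ` {..2 * j + 1})" if "\<not> K \<subseteq> cspan (e ` {..<2 * j + 1})" for j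
      using e[of "2 * j + 1"] that unfolding P_def ins by (simp add: target_def)
    show "S (e j) \<in> cspan (e ` {..2 * j + 2})" if "\<not> K \<subseteq> cspan (e ` {..<2 * j + 2})" for j
      using e[of "2 * j + 2"] that unfolding P_def ins by (simp add: target_def)
  qed
qed

text \<open>Either the queue never exhausts \<open>K\<close> and is tame, or it stops with a finite
  orthonormal basis. In the second case the growth bound is claimed only where both reserved
  positions precede \<open>m\<close>.\<close>

lemma tame_or_finite:
  fixes T :: "'a :: complex_inner \<Rightarrow> 'a"
  assumes K: "csubspace K" and TK: "T ` K \<subseteq> K" and SK: "cadjoint T ` K \<subseteq> K"
  shows "(\<exists>e. tame T e \<and> range e \<subseteq> K) \<or>
    (\<exists>e m. K = cspan (e ` {..<m :: nat}) \<and>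
      (\<forall>i<m. \<forall>j<m. cinner (e i) (e j) = (if i = j then 1 else 0)) \<and>
      (\<forall>j. 2 * j + 2 < m \<longrightarrow> T (e j) \<in> cspan (e ` {..2 * j + 2}) \<and>
         cadjoint T (e j) \<in> cspan (e ` {..2 * j + 2})))"
proof -
  obtain e :: "nat \<Rightarrow> 'a" where
    e: "\<And>n. \<not> K \<subseteq> cspan (e ` {..<n}) \<Longrightarrow>
        e n \<in> K \<and> norm (e n) = 1 \<and> (\<forall>i<n. cinner (e n) (e i) = 0)" and
    eT: "\<And>j. \<not> K \<subseteq> cspan (e ` {..<2 * j + 1}) \<Longrightarrow> T (e j) \<in> cspan (e ` {..2 * j + 1})" and
    eS: "\<And>j. \<not> K \<subseteq> cspan (e ` {..<2 * j + 2}) \<Longrightarrow>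
        cadjoint T (e j) \<in> cspan (e ` {..2 * j + 2})"
    using queue_sequence_exists[OF K TK SK] by blast
  have mono: "cspan (e ` {..2 * j + 1}) \<subseteq> cspan (e ` {..2 * j + 2})" for j
    by (intro complex_vector.span_mono) auto
  show ?thesis
  proof (cases "\<exists>n. K \<subseteq> cspan (e ` {..<n})")
    case False
    have "cinner (e i) (e j) = (if i = j then 1 else 0)" for i j
      by (rule orthonormal_if_orthogonal_to_predecessors[of "Suc (max i j)"]) (use e False in auto)
    then have "tame T e" using eT eS False mono unfolding tame_def by blast
    then show ?thesis using e False by blast
  next
    case True
    \<comment> \<open>Minimality of \<open>m\<close> makes every position before it a genuine choice
      in \<open>K\<close>, so the two spaces coincide and the vectors are orthonormal.\<close>
    define m where "m = (LEAST n. K \<subseteq> cspan (e ` {..<n}))"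
    have m: "K \<subseteq> cspan (e ` {..<m})" using True unfolding m_def by (rule LeastI_ex)
    have before: "\<not> K \<subseteq> cspan (e ` {..<n})" if "n < m" for n
      using that not_less_Least unfolding m_def by blast
    have "e ` {..<m} \<subseteq> K" using e before by blast
    then have "K = cspan (e ` {..<m})"
      using m complex_vector.span_minimal[OF _ K] by (intro subset_antisym)
    moreover have "cinner (e i) (e j) = (if i = j then 1 else 0)" if "i < m" "j < m" for i j
      by (rule orthonormal_if_orthogonal_to_predecessors[of m]) (use e before that in auto)
    moreover have "T (e j) \<in> cspan (e ` {..2 * j + 2}) \<and> cadjoint T (e j) \<in> cspan (e ` {..2 * j + 2})"
      if "2 * j + 2 < m" for j
      using eT[of j] eS[of j] before[of "2 * j + 1"] before[of "2 * j + 2"] that mono by auto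
    ultimately show ?thesis by blast
  qed
qed

text \<open>The entries fall into three ranges: the finite basis obeys its own bound early on, its
  later images lie in \<open>K\<close>, which is by then fully listed, and the shifted
  \<open>f\<close> has slack.\<close>

lemma tame_prepend:
  fixes T :: "'a :: complex_inner \<Rightarrow> 'a"
  assumes K: "K = cspan (e ` {..<m :: nat})" and TK: "T ` K \<subseteq> K" and SK: "cadjoint T ` K \<subseteq> K"
    and orth: "\<And>i j. \<lbrakk>i < m; j < m\<rbrakk> \<Longrightarrow> cinner (e i) (e j) = (if i = j then 1 else 0)"
    and e: "\<And>j. 2 * j + 2 < m \<Longrightarrow> T (e j) \<in> cspan (e ` {..2 * j + 2}) \<and>
         cadjoint T (e j) \<in> cspan (e ` {..2 * j + 2})"
    and f: "tame T f" and perp: "K \<subseteq> ortho (range f)"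
  shows "tame T (\<lambda>n. if n < m then e n else f (n - m))" (is "tame T ?g")
proof -
  have eK: "e i \<in> K" if "i < m" for i
    unfolding K using that by (intro complex_vector.span_base) auto
  have ef: "cinner (e i) (f j) = 0" "cinner (f j) (e i) = 0" if "i < m" for i j
    using perp eK[OF that] cinner_eq_0_commute by (auto simp: ortho_def)
  have "cinner (?g i) (?g j) = (if i = j then 1 else 0)" for i j
    using ef orth f by (auto simp: tame_def)
  moreover have "T (?g j) \<in> cspan (?g ` {..2 * j + 2}) \<and>
      cadjoint T (?g j) \<in> cspan (?g ` {..2 * j + 2})" for j
  proof (cases "j < m")
    case False
    \<comment> \<open>The shift adds \<open>m\<close> to every position while the allowed bound
      grows by \<open>2 * m\<close>.\<close>
    have "f i = ?g (i + m) \<and> i + m \<le> 2 * j + 2" if "i \<le> 2 * (j - m) + 2" for i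
      using False that by auto
    then have "f ` {..2 * (j - m) + 2} \<subseteq> ?g ` {..2 * j + 2}" by fast
    then have "cspan (f ` {..2 * (j - m) + 2}) \<subseteq> cspan (?g ` {..2 * j + 2})"
      by (rule complex_vector.span_mono)
    then show ?thesis using f False unfolding tame_def by auto
  next
    case True
    show ?thesis
    proof (cases "2 * j + 2 < m")
      case lt: True
      have "e ` {..2 * j + 2} = ?g ` {..2 * j + 2}" using lt by (intro image_cong) auto
      then show ?thesis using e[OF lt] True by simp
    next
      case False
      \<comment> \<open>All of \<open>e 0\<close>, ..., \<open>e (m - 1)\<close> now lie within the
        allowed positions, so their span contains the invariant space \<open>K\<close>.\<close>
      have "e i = ?g i \<and> i \<le> 2 * j + 2" if "i < m" for i using that False by simp
      then have "e ` {..<m} \<subseteq> ?g ` {..2 * j + 2}" by fast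
      then have "K \<subseteq> cspan (?g ` {..2 * j + 2})" unfolding K by (rule complex_vector.span_mono)
      moreover have "T (e j) \<in> K" "cadjoint T (e j) \<in> K" using TK SK eK[OF True] by auto
      ultimately show ?thesis using True by auto
    qed
  qed
  ultimately show ?thesis by (simp add: tame_def)
qed


section \<open>The decomposition\<close>

definition tame_spaces :: "('a :: complex_inner \<Rightarrow> 'a) \<Rightarrow> 'a set set" where
  "tame_spaces T = {closure (cspan (range e)) |e. tame T e}"

definition orthogonal_family :: "'a :: complex_inner set set \<Rightarrow> bool" where
  "orthogonal_family \<M> \<longleftrightarrow> (\<forall>M\<in>\<M>. \<forall>N\<in>\<M>. M \<noteq> N \<longrightarrow> M \<subseteq> ortho N)"

lemma orthogonal_family_insert:
  assumes "orthogonal_family \<M>" "\<And>N. N \<in> \<M> \<Longrightarrow> M \<subseteq> ortho N"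
  shows "orthogonal_family (insert M \<M>)"
proof -
  have "N \<subseteq> ortho M" if "N \<in> \<M>" for N
    using assms(2)[OF that] by (simp add: subset_ortho_commute)
  then show ?thesis using assms unfolding orthogonal_family_def by blast
qed

text \<open>Zorn's lemma applies because any two spaces from the union of a chain already occur
  together in one family of the chain.\<close>

lemma maximal_orthogonal_tame_family:
  obtains \<M> where "\<M> \<subseteq> tame_spaces T" "orthogonal_family \<M>"
    "\<And>M. \<lbrakk>M \<in> tame_spaces T; \<And>N. N \<in> \<M> \<Longrightarrow> M \<subseteq> ortho N\<rbrakk> \<Longrightarrow> M \<in> \<M>"
proof -
  define \<F> where "\<F> = {\<M>. \<M> \<subseteq> tame_spaces T \<and> orthogonal_family \<M>}"
  have "\<exists>\<M>\<in>\<F>. \<forall>\<N>\<in>\<F>. \<M> \<subseteq> \<N> \<longrightarrow> \<N> = \<M>"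
  proof (rule subset_Zorn')
    fix \<C> assume C: "subset.chain \<F> \<C>"
    have "M \<subseteq> ortho N" if MN: "M \<in> \<Union>\<C>" "N \<in> \<Union>\<C>" "M \<noteq> N" for M N
    proof -
      obtain A B where "A \<in> \<C>" "M \<in> A" "B \<in> \<C>" "N \<in> B" using MN by blast
      moreover have "A \<subseteq> B \<or> B \<subseteq> A" using C calculation by (auto simp: subset_chain_def)
      moreover have "A \<in> \<F>" "B \<in> \<F>" using C calculation by (auto simp: subset_chain_def)
      ultimately show ?thesis using \<open>M \<noteq> N\<close> unfolding \<F>_def orthogonal_family_def by blast
    qed
    then show "\<Union>\<C> \<in> \<F>"
      using C unfolding \<F>_def orthogonal_family_def subset_chain_def by blast
  qed
  then obtain \<M> where M: "\<M> \<in> \<F>" "\<And>\<N>. \<N> \<in> \<F> \<Longrightarrow> \<M> \<subseteq> \<N> \<Longrightarrow> \<N> = \<M>" by blast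
  have "M \<in> \<M>" if "M \<in> tame_spaces T" "\<And>N. N \<in> \<M> \<Longrightarrow> M \<subseteq> ortho N" for M
  proof -
    have "insert M \<M> \<in> \<F>"
      using M(1) that orthogonal_family_insert unfolding \<F>_def by blast
    then show ?thesis using M(2) by blast
  qed
  then show thesis using that[of \<M>] M(1) unfolding \<F>_def by blast
qed

text \<open>The adjoint relation exchanges the roles: invariance of \<open>A\<close> under one
  operator makes \<open>ortho A\<close> invariant under the other.\<close>

lemma ortho_invariant:
  fixes T :: "'a :: chilbert_space \<Rightarrow> 'a"
  assumes T: "bounded_clinear T"
    and A: "\<And>x. x \<in> A \<Longrightarrow> T x \<in> A" "\<And>x. x \<in> A \<Longrightarrow> cadjoint T x \<in> A"
  shows "T ` ortho A \<subseteq> ortho A" "cadjoint T ` ortho A \<subseteq> ortho A"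
proof -
  show "T ` ortho A \<subseteq> ortho A" using A by (auto simp: ortho_def cadjoint_works[OF T])
  have "cinner (cadjoint T x) y = cinner x (T y)" for x y
    using cadjoint_works[OF T, of y x] by (metis cinner_commute)
  then show "cadjoint T ` ortho A \<subseteq> ortho A" using A by (auto simp: ortho_def)
qed

theorem theorem2p6:
  fixes T :: "'a :: chilbert_space \<Rightarrow> 'a"
  assumes separable: "separable_space (euclidean :: 'a topology)"
    and infinite_dimensional: "\<not> (\<exists>B :: 'a set. finite B \<and> cspan B = UNIV)"
    and bounded: "bounded_clinear T"
  shows "\<exists>\<M> :: 'a set set.
    orthogonal_direct_sum \<M> \<and>
    (\<forall>M\<in>\<M>. reducing_subspace T M \<and> has_block_tridiagonal_form_on (\<lambda>k. 2 ^ k) T M)"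
proof -
  obtain \<M> where \<M>: "\<M> \<subseteq> tame_spaces T" "orthogonal_family \<M>"
    and max: "\<And>M. \<lbrakk>M \<in> tame_spaces T; \<And>N. N \<in> \<M> \<Longrightarrow> M \<subseteq> ortho N\<rbrakk> \<Longrightarrow> M \<in> \<M>"
    using maximal_orthogonal_tame_family by blast
  have good: "reducing_subspace T M" "has_block_tridiagonal_form_on (\<lambda>k. 2 ^ k) T M"
    if "M \<in> tame_spaces T" for M
    using that
    by (auto simp: tame_spaces_def
        intro: tame_reducing_subspace[OF bounded] tame_has_block_tridiagonal_form[OF bounded])
  define R where "R = ortho (\<Union>\<M>)"
  have "T x \<in> \<Union>\<M>" "cadjoint T x \<in> \<Union>\<M>" if x: "x \<in> \<Union>\<M>" for x
  proof -
    obtain M where "M \<in> \<M>" "x \<in> M" using x by blast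
    moreover have "T ` M \<subseteq> M" "cadjoint T ` M \<subseteq> M"
      using good(1) \<M>(1) calculation(1) by (auto simp: reducing_subspace_def)
    ultimately show "T x \<in> \<Union>\<M>" "cadjoint T x \<in> \<Union>\<M>" by auto
  qed
  then have TR: "T ` R \<subseteq> R" "cadjoint T ` R \<subseteq> R"
    unfolding R_def by (intro ortho_invariant[OF bounded]; blast)+
  have R: "csubspace R" "closed R" unfolding R_def by (rule csubspace_ortho closed_ortho)+
  \<comment> \<open>By maximality the space spanned by such a sequence would belong to
    \<open>\<M>\<close>, yet it lies in \<open>R\<close>; so \<open>e 0\<close> would be orthogonal
    to itself.\<close>
  have "\<not> (tame T e \<and> range e \<subseteq> R)" for e
  proof
    assume e: "tame T e \<and> range e \<subseteq> R"
    let ?M = "closure (cspan (range e))"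
    have MR: "?M \<subseteq> R" using e R by (intro closure_cspan_minimal) auto
    then have "?M \<subseteq> ortho N" if "N \<in> \<M>" for N using that by (auto simp: R_def ortho_def)
    then have "?M \<in> \<M>" using e by (intro max) (auto simp: tame_spaces_def)
    moreover have e0: "e 0 \<in> ?M" using subset_closure_cspan[of "range e"] by blast
    ultimately have "cinner (e 0) (e 0) = 0" using MR by (auto simp: R_def ortho_def)
    then show False using e by (simp add: tame_def)
  qed
  then obtain e m where RS: "R = cspan (e ` {..<m :: nat})"
    and e_orth: "\<And>i j. \<lbrakk>i < m; j < m\<rbrakk> \<Longrightarrow> cinner (e i) (e j) = (if i = j then 1 else 0)"
    and e_T: "\<And>j. 2 * j + 2 < m \<Longrightarrow> T (e j) \<in> cspan (e ` {..2 * j + 2}) \<and>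
         cadjoint T (e j) \<in> cspan (e ` {..2 * j + 2})"
    using tame_or_finite[OF R(1) TR] by blast
  \<comment> \<open>A member is needed to absorb \<open>R\<close>. Infinite dimension supplies it,
    since an empty family would make the finitely spanned \<open>R\<close> the whole space.\<close>
  have "\<M> \<noteq> {}"
  proof
    assume "\<M> = {}"
    then have "R = UNIV" by (simp add: R_def ortho_def)
    then show False using infinite_dimensional RS by (metis finite_imageI finite_lessThan)
  qed
  then obtain M where M: "M \<in> \<M>" by blast
  then obtain f where f: "tame T f" and Mf: "M = closure (cspan (range f))"
    using \<M>(1) unfolding tame_spaces_def by blast
  have fM: "range f \<subseteq> M" unfolding Mf by (rule subset_closure_cspan)
  define g where "g = (\<lambda>n. if n < m then e n else f (n - m))"
  define M' where "M' = closure (cspan (range g))"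
  define \<N> where "\<N> = insert M' (\<M> - {M})"
  have "R \<subseteq> ortho (range f)" using fM M unfolding R_def ortho_def by blast
  then have "tame T g" unfolding g_def by (intro tame_prepend[OF RS TR _ _ f] e_orth e_T)
  then have tame: "\<N> \<subseteq> tame_spaces T" using \<M>(1) by (auto simp: \<N>_def M'_def tame_spaces_def)
  have M'_csub: "csubspace M'" "closed M'" unfolding M'_def by (simp_all add: csubspace_closure_cspan)
  have gM': "range g \<subseteq> M'" unfolding M'_def by (rule subset_closure_cspan)
  have RM': "R \<subseteq> M'"
    unfolding RS
  proof (rule complex_vector.span_minimal[OF _ M'_csub(1)])
    have "e i = g i" if "i < m" for i using that by (simp add: g_def)
    then show "e ` {..<m} \<subseteq> M'" using gM' by fastforce
  qed
  have MM': "M \<subseteq> M'"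
    unfolding Mf
  proof (rule closure_cspan_minimal[OF _ M'_csub])
    have "f i = g (i + m)" for i by (simp add: g_def)
    then show "range f \<subseteq> M'" using gM' by fastforce
  qed
  \<comment> \<open>Each generator of \<open>M'\<close> lies in \<open>R\<close> or in
    \<open>M\<close>, and both are orthogonal to the remaining members.\<close>
  have "M' \<subseteq> ortho N" if N: "N \<in> \<M> - {M}" for N
    unfolding M'_def
  proof (rule closure_cspan_minimal[OF _ csubspace_ortho closed_ortho])
    have "R \<subseteq> ortho N" using N by (auto simp: R_def ortho_def)
    moreover have "M \<subseteq> ortho N" using N M \<M>(2) unfolding orthogonal_family_def by blast
    moreover have "e ` {..<m} \<subseteq> R" unfolding RS by (rule complex_vector.span_superset)
    ultimately have "e i \<in> ortho N" if "i < m" for i using that by blast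
    moreover have "f i \<in> ortho N" for i using fM \<open>M \<subseteq> ortho N\<close> by blast
    ultimately show "range g \<subseteq> ortho N" by (auto simp: g_def)
  qed
  moreover have "orthogonal_family (\<M> - {M})" using \<M>(2) by (simp add: orthogonal_family_def)
  ultimately have orth: "orthogonal_family \<N>"
    unfolding \<N>_def by (intro orthogonal_family_insert)
  have "closure (cspan (\<Union>\<N>)) = UNIV"
  proof (rule closed_csubspace_eq_UNIV)
    \<comment> \<open>The new family still covers the old one and also \<open>R\<close>. A vector
      orthogonal to it therefore lies in \<open>R\<close> and is orthogonal to \<open>R\<close>,
      hence is zero.\<close>
    have "\<Union>\<M> \<union> R \<subseteq> \<Union>\<N>" using RM' MM' by (auto simp: \<N>_def)
    then have sub: "\<Union>\<M> \<union> R \<subseteq> closure (cspan (\<Union>\<N>))" using subset_closure_cspan by blast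
    show "ortho (closure (cspan (\<Union>\<N>))) \<subseteq> {0}"
    proof
      fix x assume x: "x \<in> ortho (closure (cspan (\<Union>\<N>)))"
      then have "x \<in> R" using sub by (auto simp: R_def ortho_def)
      then have "cinner x x = 0" using x sub by (auto simp: ortho_def)
      then show "x \<in> {0}" by (simp add: cinner_self_eq_0_iff)
    qed
  qed (simp_all add: csubspace_closure_cspan)
  moreover have "csubspace N \<and> closed N" if "N \<in> \<N>" for N
    using good(1) tame that by (auto simp: reducing_subspace_def)
  moreover have "\<forall>x\<in>M. \<forall>y\<in>N. cinner x y = 0" if "M \<in> \<N>" "N \<in> \<N>" "M \<noteq> N" for M N
    using orth that by (auto simp: orthogonal_family_def ortho_def)
  ultimately have "orthogonal_direct_sum \<N>" unfolding orthogonal_direct_sum_def by simp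
  then show ?thesis using tame good by blast
qed

end
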